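(* Let $\beta\in\{1,2\}$ and $N\ge1$. Let $X$ be an $N\times N$ random matrix with independent identically distributed standard Gaussian entries, real if $\beta=1$ and complex if $\beta=2$. For $\theta\in[0,1)$ let $U(\theta)$ be the unitary (orthogonal if $\beta=1$) factor of the QR-decomposition $U(\theta)R(\theta)=(1-\theta)X+\theta\mathbb{I}$, where $R(\theta)$ is upper triangular with positive diagonal entries. Then for $\theta\ll 1$, the distribution of $U(\theta)$ is $\mathcal{O}(\theta)$-close in total variation distance to the Haar measure on $\mathbb{O}(N)$ (if $\beta=1$) or $\mathbb{U}(N)$ (if $\beta=2$).
   Context: The Haar measure on $\mathbb{O}(N)$ or $\mathbb{U}(N)$ is the unique probability measure invariant under left and right multiplication by fixed group elements. The total variation distance between probability measures $\mu,\nu$ is $\sup_A|\mu(A)-\nu(A)|$. The implicit constant in $\mathcal{O}(\theta)$ may depend on $N$ and $\beta$. The QR-decomposition with positive diagonal of $R$ is unique for invertible matrices, which $(1-\theta)X+\theta\mathbb{I}$ is almost surely. *)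

theory Defs
  imports "HOL-Probability.Probability"
begin

text \<open>Matrices are N x N with N = CARD('n); the index type carries a linear
order so that "upper triangular" makes sense.\<close>

definition cnj_transpose :: "complex^'n^'n \<Rightarrow> complex^'n^'n" where
  "cnj_transpose A = (\<chi> i j. cnj (A $ j $ i))"

definition unitary_matrix :: "complex^'n^'n \<Rightarrow> bool" where
  "unitary_matrix U \<longleftrightarrow> cnj_transpose U ** U = mat 1 \<and> U ** cnj_transpose U = mat 1"

definition upper_triangular :: "('a::zero)^('n::{finite,linorder})^('n::{finite,linorder}) \<Rightarrow> bool" where
  "upper_triangular R \<longleftrightarrow> (\<forall>i j. j < i \<longrightarrow> R $ i $ j = 0)"

text \<open>Orthogonal factor of the QR decomposition (R upper triangular, positive diagonal).\<close>
definition qr_Q_real :: "real^('n::{finite,linorder})^('n::{finite,linorder}) \<Rightarrow> real^('n::{finite,linorder})^('n::{finite,linorder})" where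
  "qr_Q_real A = (THE Q. orthogonal_matrix Q \<and>
      (\<exists>R. upper_triangular R \<and> (\<forall>i. R $ i $ i > 0) \<and> A = Q ** R))"

text \<open>Unitary factor of the QR decomposition (R upper triangular, real positive diagonal).\<close>
definition qr_Q_complex :: "complex^('n::{finite,linorder})^('n::{finite,linorder}) \<Rightarrow> complex^('n::{finite,linorder})^('n::{finite,linorder})" where
  "qr_Q_complex A = (THE Q. unitary_matrix Q \<and>
      (\<exists>R. upper_triangular R \<and> (\<forall>i. Im (R $ i $ i) = 0 \<and> Re (R $ i $ i) > 0) \<and> A = Q ** R))"

text \<open>Law of a real N x N matrix with iid N(0,1) entries.\<close>
definition real_ginibre :: "(real^'n^'n) measure" where
  "real_ginibre = density lborel
     (\<lambda>X. ennreal (\<Prod>i\<in>UNIV. \<Prod>j\<in>UNIV. std_normal_density (X $ i $ j)))"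

text \<open>Standard complex Gaussian: density exp(-|z|^2)/pi w.r.t. Lebesgue measure on C
  (i.e. E|z|^2 = 1).\<close>
definition std_complex_normal_density :: "complex \<Rightarrow> real" where
  "std_complex_normal_density z = exp (- (cmod z)\<^sup>2) / pi"

definition complex_ginibre :: "(complex^'n^'n) measure" where
  "complex_ginibre = density lborel
     (\<lambda>X. ennreal (\<Prod>i\<in>UNIV. \<Prod>j\<in>UNIV. std_complex_normal_density (X $ i $ j)))"

text \<open>Haar measure: Borel probability measure concentrated on the group and
  invariant under left and right multiplication by group elements.\<close>
definition haar_orthogonal :: "(real^'n^'n) measure \<Rightarrow> bool" where
  "haar_orthogonal H \<longleftrightarrow> sets H = sets borel \<and> prob_space H \<and>
     measure H {Q. orthogonal_matrix Q} = 1 \<and>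
     (\<forall>Q. orthogonal_matrix Q \<longrightarrow>
        distr H H (\<lambda>A. Q ** A) = H \<and> distr H H (\<lambda>A. A ** Q) = H)"

definition haar_unitary :: "(complex^'n^'n) measure \<Rightarrow> bool" where
  "haar_unitary H \<longleftrightarrow> sets H = sets borel \<and> prob_space H \<and>
     measure H {Q. unitary_matrix Q} = 1 \<and>
     (\<forall>Q. unitary_matrix Q \<longrightarrow>
        distr H H (\<lambda>A. Q ** A) = H \<and> distr H H (\<lambda>A. A ** Q) = H)"

definition tv_dist :: "'a measure \<Rightarrow> 'a measure \<Rightarrow> real" where
  "tv_dist M N = (SUP A\<in>sets M. \<bar>measure M A - measure N A\<bar>)"

end

theory Submission
  imports Defs
begin

text \<open>Since the Q factor is invariant under positive scaling, \<open>U(\<theta>) = Q(X + s I)\<close> with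
  \<open>s = \<theta> / (1 - \<theta>)\<close>. The Gaussian law of \<open>X\<close> is invariant under left multiplication by
  unitary matrices and \<open>Q(U A) = U Q(A)\<close>; averaging this identity against the right invariant
  Haar measure and exchanging the integrals shows that \<open>Q(X)\<close> is Haar distributed. Hence the
  total variation distance between the laws of \<open>Q(X + s I)\<close> and \<open>Q(X)\<close> is at most the
  \<open>L\<^sup>1\<close> distance between the Gaussian density and its translate by \<open>s I\<close>, which is \<open>O(s)\<close>.
  The real and the complex case are treated together, over a normed field with a conjugation.\<close>

section \<open>Matrix preliminaries\<close>

definition positive_diagonal :: "'k::real_normed_field^'n^'n \<Rightarrow> bool" where
  "positive_diagonal R \<longleftrightarrow> (\<forall>i. \<exists>r>0. R$i$i = of_real r)"

definition pos_index :: "'n::{finite,linorder} \<Rightarrow> nat" where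
  "pos_index j = card {i. i < j}"

lemma pos_index_less_iff: "pos_index i < pos_index j \<longleftrightarrow> i < j"
proof
  assume "i < j"
  then have "{i'. i' < i} \<subset> {i'. i' < j}" by auto
  then show "pos_index i < pos_index j"
    unfolding pos_index_def by (rule psubset_card_mono[rotated]) simp
next
  assume less: "pos_index i < pos_index j"
  show "i < j"
  proof (rule ccontr)
    assume "\<not> i < j"
    then have "{i'. i' < j} \<subseteq> {i'. i' < i}" by auto
    then have "pos_index j \<le> pos_index i" unfolding pos_index_def by (intro card_mono) simp_all
    with less show False by simp
  qed
qed

lemma finite_linorder_less_induct [case_names less]:
  fixes j :: "'n::{finite,linorder}"
  assumes "\<And>j. (\<And>i. i < j \<Longrightarrow> P i) \<Longrightarrow> P j"
  shows "P j"
  by (induction j rule: measure_induct_rule[where f = pos_index]) (use assms pos_index_less_iff in blast)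

lemma upper_triangular_mult_vec_eq_0:
  fixes R :: "'k::field^('n::{finite,linorder})^('n::{finite,linorder})"
  assumes R: "upper_triangular R" "\<And>i. R$i$i \<noteq> 0" and w: "R *v w = 0"
  shows "w = 0"
proof (rule ccontr)
  assume "w \<noteq> 0"
  then have ne: "{l. w$l \<noteq> 0} \<noteq> {}" by (auto simp: vec_eq_iff)
  define j where "j = Max {l. w$l \<noteq> 0}"
  have wj: "w$j \<noteq> 0" using Max_in[OF _ ne] unfolding j_def by simp
  have above: "w$l = 0" if "j < l" for l
    using Max_ge[of "{l. w$l \<noteq> 0}" l] that unfolding j_def by fastforce
  have "(R *v w)$j = R$j$j * w$j + (\<Sum>l\<in>UNIV-{j}. R$j$l * w$l)"
    by (simp add: matrix_vector_mult_def sum.remove)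
  also have "(\<Sum>l\<in>UNIV-{j}. R$j$l * w$l) = 0"
    using R(1) above by (intro sum.neutral) (auto simp: upper_triangular_def neq_iff)
  finally show False using w wj R(2)[of j] by simp
qed

lemma column_matrix_mult:
  fixes Q :: "'a::comm_semiring_1^'m^'n"
  shows "column j (Q ** R) = (\<Sum>l\<in>UNIV. R$l$j *s column l Q)"
  by (simp add: vec_eq_iff column_def matrix_matrix_mult_def sum_component mult.commute)

lemma det_neq_0_iff_mult_vec_inj:
  fixes A :: "'a::field^'n^'n"
  shows "det A \<noteq> 0 \<longleftrightarrow> (\<forall>w. A *v w = 0 \<longrightarrow> w = 0)"
  by (simp add: invertible_det_nz[symmetric] invertible_left_inverse matrix_left_invertible_ker)

lemma matrix_vector_mult_axis_1: "(A::'a::semiring_1^'n^'m) *v axis j 1 = column j A"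
  by (simp add: vec_eq_iff matrix_vector_mult_def column_def axis_def if_distrib sum.delta' cong: if_cong)

lemma continuous_on_vector_smult [continuous_intros]:
  fixes f :: "'a::topological_space \<Rightarrow> 'k::real_normed_field^'n"
  shows "continuous_on S c \<Longrightarrow> continuous_on S f \<Longrightarrow> continuous_on S (\<lambda>x. c x *s f x)"
  unfolding vector_scalar_mult_def by (intro continuous_intros)

lemma continuous_on_column [continuous_intros]:
  fixes f :: "'a::topological_space \<Rightarrow> 'k::real_normed_vector^'n^'m"
  shows "continuous_on S f \<Longrightarrow> continuous_on S (\<lambda>x. column j (f x))"
  unfolding column_def by (intro continuous_intros)

lemma continuous_on_det [continuous_intros]:
  fixes f :: "'a::topological_space \<Rightarrow> 'k::real_normed_field^'n^'n"
  shows "continuous_on S f \<Longrightarrow> continuous_on S (\<lambda>x. det (f x))"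
  unfolding det_def by (intro continuous_intros)

lemma continuous_on_matrix_mult [continuous_intros]:
  fixes F :: "'a::topological_space \<Rightarrow> 'k::real_normed_field^'m^'n" and G :: "'a \<Rightarrow> 'k^'p^'m"
  shows "continuous_on S F \<Longrightarrow> continuous_on S G \<Longrightarrow> continuous_on S (\<lambda>x. F x ** G x)"
  unfolding matrix_matrix_mult_def by (intro continuous_intros)

lemma open_det_neq_0: "open {A :: 'k::real_normed_field^'n^'n. det A \<noteq> 0}"
  by (intro open_Collect_neq continuous_intros)

lemma closed_det_eq_0: "closed {A :: 'k::real_normed_field^'n^'n. det A = 0}"
  by (intro closed_Collect_eq continuous_intros)

lemma norm_vec_power2: "(norm (v::'a::real_normed_vector^'n))\<^sup>2 = (\<Sum>i\<in>UNIV. (norm (v$i))\<^sup>2)"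
  by (simp add: norm_vec_def L2_set_def sum_nonneg)

lemma norm_power2_columns:
  "(norm (X::'a::real_normed_vector^'n^'m))\<^sup>2 = (\<Sum>j\<in>UNIV. (norm (column j X))\<^sup>2)"
proof -
  have "(norm X)\<^sup>2 = (\<Sum>i\<in>UNIV. \<Sum>j\<in>UNIV. (norm (X$i$j))\<^sup>2)"
    by (simp add: norm_vec_power2)
  also have "\<dots> = (\<Sum>j\<in>UNIV. \<Sum>i\<in>UNIV. (norm (X$i$j))\<^sup>2)"
    by (rule sum.swap)
  finally show ?thesis
    by (simp add: norm_vec_power2 column_def)
qed

lemma column_matrix_mult_left: "column j ((U::'a::semiring_1^'n^'m) ** X) = U *v column j X"
  by (simp add: vec_eq_iff column_def matrix_matrix_mult_def matrix_vector_mult_def)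

lemma linear_matrix_mult_left: "linear (\<lambda>X::'a::real_algebra_1^'n^'m. U ** X)"
  by (rule linearI) (simp_all add: matrix_add_ldistrib matrix_scalar_ac scalar_matrix_assoc)

section \<open>Fields with a conjugation\<close>

locale conjugation =
  fixes cj :: "'k::real_normed_field \<Rightarrow> 'k"
  assumes cj_add: "cj (x + y) = cj x + cj y"
    and cj_mult: "cj (x * y) = cj x * cj y"
    and cj_cj [simp]: "cj (cj x) = x"
    and cj_of_real [simp]: "cj (of_real r) = of_real r"
    and cj_mult_self: "cj x * x = of_real ((norm x)\<^sup>2)"
    and continuous_on_cj: "continuous_on UNIV cj"
begin

lemma cj_zero [simp]: "cj 0 = 0"
  using cj_of_real[of 0] by simp

lemma cj_sum: "cj (sum f S) = (\<Sum>i\<in>S. cj (f i))"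
  by (induction S rule: infinite_finite_induct) (auto simp: cj_add)

definition hinner :: "'k^'n \<Rightarrow> 'k^'n \<Rightarrow> 'k" where
  "hinner u v = (\<Sum>i\<in>UNIV. cj (u$i) * v$i)"

definition conj_transpose :: "'k^'n^'n \<Rightarrow> 'k^'n^'n" where
  "conj_transpose A = (\<chi> i j. cj (A$j$i))"

definition unitary :: "'k^'n^'n \<Rightarrow> bool" where
  "unitary Q \<longleftrightarrow> conj_transpose Q ** Q = mat 1 \<and> Q ** conj_transpose Q = mat 1"

definition qr_Q :: "'k^('n::{finite,linorder})^('n::{finite,linorder}) \<Rightarrow> 'k^('n::{finite,linorder})^('n::{finite,linorder})" where
  "qr_Q A = (THE Q. unitary Q \<and> (\<exists>R. upper_triangular R \<and> positive_diagonal R \<and> A = Q ** R))"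

definition haar :: "('k^'n^'n) measure \<Rightarrow> bool" where
  "haar H \<longleftrightarrow> sets H = sets borel \<and> prob_space H \<and> measure H {Q. unitary Q} = 1 \<and>
     (\<forall>Q. unitary Q \<longrightarrow> distr H H (\<lambda>A. Q ** A) = H \<and> distr H H (\<lambda>A. A ** Q) = H)"

lemma hinner_commute: "hinner u v = cj (hinner v u)"
  unfolding hinner_def cj_sum by (simp add: cj_mult mult.commute)

lemma hinner_add_right: "hinner u (v + w) = hinner u v + hinner u w"
  unfolding hinner_def by (simp add: distrib_left sum.distrib)

lemma hinner_diff_right: "hinner u (v - w) = hinner u v - hinner u w"
  unfolding hinner_def by (simp add: right_diff_distrib sum_subtractf)

lemma hinner_smult_right: "hinner u (c *s v) = c * hinner u v"
  unfolding hinner_def by (simp add: sum_distrib_left mult.left_commute)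

lemma hinner_smult_left: "hinner (c *s u) v = cj c * hinner u v"
  unfolding hinner_def by (simp add: sum_distrib_left cj_mult mult.assoc)

lemma scaleR_eq_of_real_smult: "r *\<^sub>R v = (of_real r :: 'k) *s v"
  by (simp add: vec_eq_iff) (simp add: scaleR_conv_of_real)

lemma hinner_scaleR_right: "hinner u (r *\<^sub>R v) = of_real r * hinner u v"
  by (simp add: scaleR_eq_of_real_smult hinner_smult_right)

lemma hinner_sum_right: "hinner u (sum f S) = (\<Sum>l\<in>S. hinner u (f l))"
  unfolding hinner_def by (simp add: sum_component sum_distrib_left sum.swap[of _ S])

lemma hinner_self: "hinner v v = of_real ((norm v)\<^sup>2)"
  unfolding hinner_def norm_vec_def L2_set_def by (simp add: sum_nonneg cj_mult_self)

lemma hinner_orthonormal_sum: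
  assumes "\<And>l. l \<in> S \<Longrightarrow> hinner u (q l) = (if l = i then 1 else 0)" "finite S"
  shows "hinner u (\<Sum>l\<in>S. c l *s q l) = (if i \<in> S then c i else 0)"
proof -
  have "hinner u (\<Sum>l\<in>S. c l *s q l) = (\<Sum>l\<in>S. if l = i then c l else 0)"
    unfolding hinner_sum_right hinner_smult_right using assms(1) by (intro sum.cong) auto
  then show ?thesis using assms(2) by (simp add: sum.delta')
qed

lemma conj_transpose_mult_nth: "(conj_transpose A ** B)$i$j = hinner (column i A) (column j B)"
  unfolding conj_transpose_def hinner_def matrix_matrix_mult_def column_def by simp

lemma conj_transpose_mult: "conj_transpose (A ** B) = conj_transpose B ** conj_transpose A"
  by (simp add: vec_eq_iff conj_transpose_def matrix_matrix_mult_def cj_sum cj_mult mult.commute)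

lemma unitary_iff_left_inverse: "unitary Q \<longleftrightarrow> conj_transpose Q ** Q = mat 1"
  unfolding unitary_def using matrix_left_right_inverse by blast

lemma unitary_mult: "unitary P \<Longrightarrow> unitary Q \<Longrightarrow> unitary (P ** Q)"
  unfolding unitary_iff_left_inverse
  by (metis conj_transpose_mult matrix_mul_assoc matrix_mul_lid)

lemma unitary_hinner_columns:
  "unitary Q \<Longrightarrow> hinner (column i Q) (column j Q) = (if i = j then 1 else 0)"
  unfolding unitary_iff_left_inverse by (simp add: conj_transpose_mult_nth[symmetric] mat_def)

lemma unitary_hinner_column_mult:
  "unitary Q \<Longrightarrow> hinner (column i Q) (column j (Q ** R)) = R$i$j"
  unfolding column_matrix_mult
  by (subst hinner_orthonormal_sum[where i = i]) (auto simp: unitary_hinner_columns)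

end

locale euclidean_conjugation = conjugation cj for cj :: "'k::{real_normed_field,euclidean_space} \<Rightarrow> 'k"

section \<open>The QR decomposition\<close>

context conjugation
begin

lemma qr_unique:
  fixes Q1 Q2 R1 R2 :: "'k^('n::{finite,linorder})^('n::{finite,linorder})"
  assumes Q1: "unitary Q1" and Q2: "unitary Q2"
    and R1: "upper_triangular R1" "positive_diagonal R1"
    and R2: "upper_triangular R2" "positive_diagonal R2"
    and eq: "Q1 ** R1 = Q2 ** R2"
  shows "Q1 = Q2"
proof -
  have col: "column j Q1 = column j Q2" for j
  proof (induction j rule: finite_linorder_less_induct)
    case (less j)
    have "R1$i$j = R2$i$j" if "i < j" for i
      using unitary_hinner_column_mult[OF Q1, of i j R1] unitary_hinner_column_mult[OF Q2, of i j R2]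
      by (simp add: eq less[OF that])
    then have same: "R1$l$j *s column l Q1 = R2$l$j *s column l Q2" if "l \<noteq> j" for l
      using that R1(1) R2(1) less by (cases "l < j") (auto simp: upper_triangular_def)
    define D where "D = (\<Sum>l\<in>UNIV-{j}. R1$l$j *s column l Q1)"
    have D2: "D = (\<Sum>l\<in>UNIV-{j}. R2$l$j *s column l Q2)"
      unfolding D_def using same by (intro sum.cong) auto
    have "column j (Q1 ** R1) = R1$j$j *s column j Q1 + D"
      unfolding column_matrix_mult D_def by (simp add: sum.remove)
    moreover have "column j (Q2 ** R2) = R2$j$j *s column j Q2 + D"
      unfolding column_matrix_mult D2 by (simp add: sum.remove)
    ultimately have e: "R1$j$j *s column j Q1 = R2$j$j *s column j Q2"
      by (simp add: eq)
    obtain r1 r2 where r: "r1 > 0" "R1$j$j = of_real r1" "r2 > 0" "R2$j$j = of_real r2"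
      using R1(2) R2(2) unfolding positive_diagonal_def by meson
    have "hinner (R1$j$j *s column j Q1) (R1$j$j *s column j Q1) = of_real (r1 * r1)"
      "hinner (R2$j$j *s column j Q2) (R2$j$j *s column j Q2) = of_real (r2 * r2)"
      using r by (simp_all add: hinner_smult_left hinner_smult_right unitary_hinner_columns Q1 Q2)
    then have "r1 * r1 = r2 * r2" by (metis e of_real_eq_iff)
    then have "r1 = r2" using r(1,3) by (metis less_le power2_eq_iff_nonneg power2_eq_square)
    then show ?case using e r by (simp add: vector_mul_lcancel)
  qed
  show ?thesis using col by (simp add: vec_eq_iff column_def)
qed

lemma qr_Q_eqI:
  assumes "unitary Q" "upper_triangular R" "positive_diagonal R"
  shows "qr_Q (Q ** R) = Q"
  unfolding qr_Q_def using assms qr_unique by (intro the_equality) blast+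

lemma det_qr_neq_0:
  assumes Q: "unitary Q" and R: "upper_triangular R" "positive_diagonal R"
  shows "det (Q ** R) \<noteq> 0"
  unfolding det_neq_0_iff_mult_vec_inj
proof (intro allI impI)
  fix w assume "(Q ** R) *v w = 0"
  then have "R *v w = 0"
    using Q unfolding unitary_iff_left_inverse
    by (metis matrix_mul_assoc matrix_mul_lid matrix_vector_mul_assoc matrix_vector_mult_0_right)
  moreover have "R$i$i \<noteq> 0" for i
    using R(2) unfolding positive_diagonal_def by (metis of_real_eq_0_iff order_less_irrefl)
  ultimately show "w = 0" using upper_triangular_mult_vec_eq_0 R(1) by blast
qed

lemma qr_Q_singular: "det A = 0 \<Longrightarrow> qr_Q A = (THE Q. False)"
  unfolding qr_Q_def using det_qr_neq_0 by metis

lemma qr_Q_scaleR: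
  fixes A :: "'k^('n::{finite,linorder})^('n::{finite,linorder})"
  assumes "c > 0"
  shows "qr_Q (c *\<^sub>R A) = qr_Q A"
proof -
  have pd: "positive_diagonal (a *\<^sub>R R)" if "a > 0" "positive_diagonal R" for a and R :: "'k^('n::{finite,linorder})^('n::{finite,linorder})"
    using that unfolding positive_diagonal_def
    by (metis mult_pos_pos of_real_mult scaleR_conv_of_real vector_scaleR_component)
  have ut: "upper_triangular (a *\<^sub>R R)" if "upper_triangular R" for a and R :: "'k^('n::{finite,linorder})^('n::{finite,linorder})"
    using that unfolding upper_triangular_def by simp
  have "(\<exists>R. upper_triangular R \<and> positive_diagonal R \<and> c *\<^sub>R A = Q ** R)
    \<longleftrightarrow> (\<exists>R. upper_triangular R \<and> positive_diagonal R \<and> A = Q ** R)" for Q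
  proof
    assume "\<exists>R. upper_triangular R \<and> positive_diagonal R \<and> c *\<^sub>R A = Q ** R"
    then obtain R where "upper_triangular R" "positive_diagonal R" "c *\<^sub>R A = Q ** R" by blast
    moreover have "Q ** (inverse c *\<^sub>R R) = inverse c *\<^sub>R (c *\<^sub>R A)"
      by (simp add: matrix_scalar_ac scalar_matrix_assoc[symmetric] \<open>c *\<^sub>R A = Q ** R\<close>)
    then have "A = Q ** (inverse c *\<^sub>R R)" using assms by simp
    ultimately show "\<exists>R. upper_triangular R \<and> positive_diagonal R \<and> A = Q ** R"
      using assms ut pd by (metis inverse_positive_iff_positive)
  next
    assume "\<exists>R. upper_triangular R \<and> positive_diagonal R \<and> A = Q ** R"
    then obtain R where "upper_triangular R" "positive_diagonal R" "A = Q ** R" by blast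
    then show "\<exists>R. upper_triangular R \<and> positive_diagonal R \<and> c *\<^sub>R A = Q ** R"
      using assms ut pd by (metis matrix_scalar_ac scalar_matrix_assoc)
  qed
  then show ?thesis unfolding qr_Q_def by simp
qed

text \<open>Gram--Schmidt, processing the columns in the order of the index type: after \<open>k\<close>
  stages, the vectors of the first \<open>k\<close> indices are final.\<close>

primrec gs_stage :: "'k^('n::{finite,linorder})^('n::{finite,linorder}) \<Rightarrow> nat \<Rightarrow> ('n::{finite,linorder}) \<Rightarrow> 'k^('n::{finite,linorder})" where
  "gs_stage A 0 = (\<lambda>j. 0)"
| "gs_stage A (Suc k) = (\<lambda>j. if pos_index j = k
      then sgn (column j A - (\<Sum>i | pos_index i < k. hinner (gs_stage A k i) (column j A) *s gs_stage A k i))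
      else gs_stage A k j)"

definition gs_col :: "'k^('n::{finite,linorder})^('n::{finite,linorder}) \<Rightarrow> ('n::{finite,linorder}) \<Rightarrow> 'k^('n::{finite,linorder})" where
  "gs_col A j = gs_stage A (Suc (pos_index j)) j"

definition gs_residual :: "'k^('n::{finite,linorder})^('n::{finite,linorder}) \<Rightarrow> ('n::{finite,linorder}) \<Rightarrow> 'k^('n::{finite,linorder})" where
  "gs_residual A j = column j A - (\<Sum>i | i < j. hinner (gs_col A i) (column j A) *s gs_col A i)"

definition gs_matrix :: "'k^('n::{finite,linorder})^('n::{finite,linorder}) \<Rightarrow> 'k^('n::{finite,linorder})^('n::{finite,linorder})" where
  "gs_matrix A = (\<chi> i j. gs_col A j $ i)"

lemma gs_stage_final: "pos_index i < k \<Longrightarrow> gs_stage A k i = gs_col A i"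
  unfolding gs_col_def by (induction k) (auto simp: less_Suc_eq)

lemma gs_col_eq: "gs_col A j = sgn (gs_residual A j)"
proof -
  have "{i. pos_index i < pos_index j} = {i. i < j}" by (simp add: pos_index_less_iff)
  moreover have "gs_stage A (pos_index j) i = gs_col A i" if "i < j" for i
    using that by (simp add: gs_stage_final pos_index_less_iff)
  ultimately show ?thesis
    unfolding gs_residual_def gs_col_def[of A j] by (auto intro!: arg_cong[where f = sgn] sum.cong)
qed

lemma column_gs_matrix [simp]: "column j (gs_matrix A) = gs_col A j"
  unfolding gs_matrix_def column_def by (simp add: vec_eq_iff)

lemma gs_residual_combination:
  "\<exists>t. (\<forall>l. j < l \<longrightarrow> t$l = 0) \<and> t$j = 1 \<and> gs_residual A j = A *v t"
proof (induction j rule: finite_linorder_less_induct)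
  case (less j)
  have "\<exists>s. (\<forall>l. i < l \<longrightarrow> s$l = 0) \<and> gs_col A i = A *v s" if ij: "i < j" for i
  proof -
    obtain t where t: "\<forall>l. i < l \<longrightarrow> t$l = 0" "gs_residual A i = A *v t"
      using less[OF ij] by blast
    have "gs_col A i = A *v (inverse (norm (gs_residual A i)) *\<^sub>R t)"
      by (simp add: gs_col_eq sgn_div_norm t(2) scaleR_eq_of_real_smult vec.scale)
    then show ?thesis using t(1) by (intro exI[of _ "t /\<^sub>R norm (gs_residual A i)"]) simp
  qed
  then obtain s where s: "\<And>i. i < j \<Longrightarrow> (\<forall>l. i < l \<longrightarrow> s i $ l = 0) \<and> gs_col A i = A *v s i"
    by metis
  define c where "c i = hinner (gs_col A i) (column j A)" for i
  define t where "t = axis j 1 - (\<Sum>i | i < j. c i *s s i)"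
  have "(\<Sum>i | i < j. c i *s gs_col A i) = (\<Sum>i | i < j. c i *s (A *v s i))"
    using s by (intro sum.cong) auto
  then have "gs_residual A j = A *v t"
    unfolding gs_residual_def t_def c_def[symmetric]
    by (simp add: vec.diff vec.sum vec.scale matrix_vector_mult_axis_1)
  moreover have "(\<Sum>i | i < j. c i *s s i) $ l = 0" if "j \<le> l" for l
    using s that by (simp add: sum_component)
  ultimately show ?case
    by (intro exI[of _ t]) (auto simp: t_def axis_def)
qed

lemma gs_residual_neq_0: "det A \<noteq> 0 \<Longrightarrow> gs_residual A j \<noteq> 0"
  using gs_residual_combination[of j A] det_neq_0_iff_mult_vec_inj
  by (metis zero_index zero_neq_one)

lemma gs_col_orthonormal:
  fixes A :: "'k^('n::{finite,linorder})^('n::{finite,linorder})"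
  assumes A: "det A \<noteq> 0"
  shows "hinner (gs_col A i) (gs_col A j) = (if i = j then 1 else 0)"
proof -
  have upto: "\<forall>i\<le>j. hinner (gs_col A i) (gs_col A j) = (if i = j then 1 else 0)" for j
  proof (induction j rule: finite_linorder_less_induct)
    case (less j)
    let ?q = "gs_col A" and ?r = "gs_residual A j"
    have orth: "hinner (?q i) (?q l) = (if l = i then 1 else 0)" if "i < j" "l < j" for i l
      using less[OF that(1)] less[OF that(2)] hinner_commute[of "?q i" "?q l"]
      by (cases "i \<le> l") auto
    have perp: "hinner (?q i) ?r = 0" if "i < j" for i
      unfolding gs_residual_def hinner_diff_right
      by (subst hinner_orthonormal_sum[where i = i]) (use orth that in auto)
    have "hinner (?q j) (?q j) = 1"
      using gs_residual_neq_0[OF A, of j] by (simp add: gs_col_eq hinner_self norm_sgn)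
    moreover have "hinner (?q i) (?q j) = 0" if "i < j" for i
      using perp[OF that] by (simp add: gs_col_eq sgn_div_norm hinner_scaleR_right)
    ultimately show ?case by (auto simp: le_less)
  qed
  show ?thesis
    using upto[of i] upto[of j] hinner_commute[of "gs_col A i" "gs_col A j"]
    by (cases "i \<le> j") (auto simp: not_le less_imp_le)
qed

lemma gs_matrix_qr:
  fixes A :: "'k^('n::{finite,linorder})^('n::{finite,linorder})"
  assumes A: "det A \<noteq> 0"
  defines "R \<equiv> conj_transpose (gs_matrix A) ** A"
  shows "unitary (gs_matrix A)" "upper_triangular R" "positive_diagonal R" "A = gs_matrix A ** R"
proof -
  show U: "unitary (gs_matrix A)"
    unfolding unitary_iff_left_inverse
    by (simp add: vec_eq_iff conj_transpose_mult_nth gs_col_orthonormal[OF A] mat_def)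
  then show "A = gs_matrix A ** R"
    unfolding R_def unitary_def by (simp add: matrix_mul_assoc)
  have R_nth: "R$i$j = (if i < j then hinner (gs_col A i) (column j A) else 0)
      + (if i = j then of_real (norm (gs_residual A j)) else 0)" for i j
  proof -
    define r where "r = gs_residual A j"
    define S where "S = (\<Sum>l | l < j. hinner (gs_col A l) (column j A) *s gs_col A l)"
    have "norm r *\<^sub>R gs_col A j = r"
      using gs_residual_neq_0[OF A, of j] by (simp add: r_def gs_col_eq sgn_div_norm)
    moreover have "column j A = S + r"
      unfolding r_def S_def gs_residual_def by simp
    ultimately have col: "column j A = S + norm r *\<^sub>R gs_col A j" by simp
    have "R$i$j = hinner (gs_col A i) S + of_real (norm r) * hinner (gs_col A i) (gs_col A j)"
      unfolding R_def conj_transpose_mult_nth column_gs_matrix col hinner_add_right hinner_scaleR_right ..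
    also have "hinner (gs_col A i) S = (if i < j then hinner (gs_col A i) (column j A) else 0)"
      unfolding S_def by (subst hinner_orthonormal_sum[where i = i]) (auto simp: gs_col_orthonormal[OF A])
    finally show ?thesis by (simp add: r_def gs_col_orthonormal[OF A])
  qed
  show "upper_triangular R"
    unfolding upper_triangular_def R_nth by auto
  show "positive_diagonal R"
    unfolding positive_diagonal_def R_nth using gs_residual_neq_0[OF A] by auto
qed

lemma qr_Q_eq_gs_matrix:
  fixes A :: "'k^('n::{finite,linorder})^('n::{finite,linorder})"
  assumes "det A \<noteq> 0"
  shows "qr_Q A = gs_matrix A"
  using qr_Q_eqI[OF gs_matrix_qr(1-3)[OF assms]] gs_matrix_qr(4)[OF assms] by simp

lemma qr_Q_decomposition:
  fixes A :: "'k^('n::{finite,linorder})^('n::{finite,linorder})"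
  assumes "det A \<noteq> 0"
  obtains R where "unitary (qr_Q A)" "upper_triangular R" "positive_diagonal R" "A = qr_Q A ** R"
  using gs_matrix_qr[OF assms] qr_Q_eq_gs_matrix[OF assms] by metis

lemma qr_Q_unitary_mult:
  fixes A U :: "'k^('n::{finite,linorder})^('n::{finite,linorder})"
  assumes U: "unitary U" and A: "det A \<noteq> 0"
  shows "qr_Q (U ** A) = U ** qr_Q A"
proof -
  obtain R where "unitary (qr_Q A)" "upper_triangular R" "positive_diagonal R" "A = qr_Q A ** R"
    using qr_Q_decomposition[OF A] .
  then show ?thesis
    using qr_Q_eqI[OF unitary_mult[OF U]] by (metis matrix_mul_assoc)
qed

end

section \<open>Measurability of the Q factor\<close>

context conjugation
begin

lemma continuous_on_hinner [continuous_intros]: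
  "continuous_on S f \<Longrightarrow> continuous_on S g \<Longrightarrow> continuous_on S (\<lambda>x. hinner (f x) (g x))"
  unfolding hinner_def
  by (intro continuous_intros continuous_on_compose2[OF continuous_on_cj]) auto

lemma continuous_on_gs_col:
  "continuous_on {A :: 'k^('n::{finite,linorder})^('n::{finite,linorder}). det A \<noteq> 0} (\<lambda>A. gs_col A j)"
proof (induction j rule: finite_linorder_less_induct)
  case (less j)
  have "continuous_on {A. det A \<noteq> 0} (\<lambda>A. sgn (gs_residual A j))"
    unfolding gs_residual_def using gs_residual_neq_0[unfolded gs_residual_def]
    by (intro continuous_intros less) auto
  then show ?case by (simp add: gs_col_eq)
qed

lemma qr_Q_measurable [measurable]:
  "(qr_Q :: 'k^('n::{finite,linorder})^('n::{finite,linorder}) \<Rightarrow> _) \<in> borel_measurable borel"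
proof -
  have "qr_Q = (\<lambda>A :: 'k^('n::{finite,linorder})^('n::{finite,linorder}). if A \<in> {A. det A \<noteq> 0} then gs_matrix A else (THE Q. False))"
    using qr_Q_eq_gs_matrix qr_Q_singular by fastforce
  moreover have "continuous_on {A :: 'k^('n::{finite,linorder})^('n::{finite,linorder}). det A \<noteq> 0} gs_matrix"
    unfolding gs_matrix_def by (intro continuous_intros continuous_on_gs_col)
  ultimately show ?thesis
    by (simp only:) (rule borel_measurable_continuous_on_if, auto intro: borel_open open_det_neq_0)
qed

end

section \<open>Singular matrices form a null set\<close>

text \<open>Every singular matrix is \<open>fill_column k Y\<close> for some \<open>k\<close> and some \<open>Y\<close> with \<open>Y$k$k = 0\<close>:
  the entries of column \<open>k\<close> of \<open>Y\<close> are the coefficients expressing column \<open>k\<close> through the others.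
  So the singular matrices are covered by finitely many smooth images of hyperplanes.\<close>

definition fill_column :: "'n \<Rightarrow> 'k::real_normed_field^'n^'n \<Rightarrow> 'k^'n^'n" where
  "fill_column k Y = (\<chi> i j. if j = k then (\<Sum>l\<in>UNIV-{k}. Y$l$k * Y$i$l) else Y$i$j)"

lemma differentiable_matrix_nth:
  "(\<lambda>Y::'k::real_normed_field^'n^'m. Y $ p $ q) differentiable at a"
  by (intro bounded_linear_imp_differentiable bounded_linear_compose[OF bounded_linear_vec_nth]
      bounded_linear_vec_nth)

lemma differentiable_fill_column_nth:
  "(\<lambda>Y::'k::real_normed_field^'n^'n. fill_column k Y $ i $ j) differentiable at a"
proof (cases "j = k")
  case True
  then show ?thesis
    by (simp add: fill_column_def differentiable_matrix_nth differentiable_sum differentiable_mult)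
next
  case False
  then show ?thesis by (simp add: fill_column_def differentiable_matrix_nth)
qed

lemma differentiable_on_fill_column:
  "(fill_column k :: 'k::{real_normed_field,euclidean_space}^'n^'n \<Rightarrow> _) differentiable_on S"
  unfolding differentiable_on_def
proof
  fix a assume "a \<in> S"
  show "fill_column k differentiable at a within S"
  proof (rule differentiable_componentwise_within[THEN iffD2], rule ballI)
    fix b :: "'k^'n^'n" assume "b \<in> Basis"
    then obtain i j e where e: "e \<in> (Basis :: 'k set)" "b = axis i (axis j e)"
      unfolding Basis_vec_def by blast
    have eq: "(\<lambda>x. fill_column k x \<bullet> b) = (\<lambda>x. (fill_column k x $ i $ j) \<bullet> e)"
      unfolding e(2) inner_axis ..
    show "(\<lambda>x. fill_column k x \<bullet> b) differentiable at a within S"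
      unfolding eq
      by (rule differentiable_compose[where f = "\<lambda>z. z \<bullet> e"],
          rule bounded_linear_imp_differentiable[OF bounded_linear_inner_left],
          rule differentiable_at_withinI, rule differentiable_fill_column_nth)
  qed
qed

lemma singular_subset_fill_column_image:
  "{A :: 'k::real_normed_field^'n^'n. det A = 0} \<subseteq> (\<Union>k. fill_column k ` {Y. Y$k$k = 0})"
proof
  fix A :: "'k^'n^'n" assume "A \<in> {A. det A = 0}"
  then obtain w where w: "A *v w = 0" "w \<noteq> 0" using det_neq_0_iff_mult_vec_inj by blast
  then obtain k where k: "w $ k \<noteq> 0" by (auto simp: vec_eq_iff)
  define Y where "Y = (\<chi> i j. if j = k then (if i = k then 0 else - w$i / w$k) else A$i$j)"
  have "A$i$k = (\<Sum>l\<in>UNIV-{k}. Y$l$k * Y$i$l)" for i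
  proof -
    have "0 = (A *v w) $ i" using w(1) by simp
    also have "\<dots> = A$i$k * w$k + (\<Sum>l\<in>UNIV-{k}. A$i$l * w$l)"
      by (simp add: matrix_vector_mult_def sum.remove)
    finally have "A$i$k * w$k = - (\<Sum>l\<in>UNIV-{k}. A$i$l * w$l)"
      by (simp add: eq_neg_iff_add_eq_0)
    then have "A$i$k = - (\<Sum>l\<in>UNIV-{k}. A$i$l * w$l) / w$k"
      using k by (metis minus_divide_left nonzero_mult_div_cancel_right)
    also have "\<dots> = (\<Sum>l\<in>UNIV-{k}. - (A$i$l * w$l) / w$k)"
      by (simp add: sum_divide_distrib sum_negf)
    also have "\<dots> = (\<Sum>l\<in>UNIV-{k}. Y$l$k * Y$i$l)"
      by (rule sum.cong) (auto simp: Y_def)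
    finally show ?thesis .
  qed
  then have "fill_column k Y = A"
    by (simp add: vec_eq_iff fill_column_def Y_def)
  moreover have "Y$k$k = 0" unfolding Y_def by simp
  ultimately show "A \<in> (\<Union>k. fill_column k ` {Y. Y$k$k = 0})" by blast
qed

lemma negligible_singular_matrices:
  "negligible {A :: 'k::{real_normed_field,euclidean_space}^'n^'n. det A = 0}"
proof (rule negligible_subset[OF _ singular_subset_fill_column_image], intro negligible_Union ballI)
  fix T assume "T \<in> range (\<lambda>k. fill_column k ` {Y :: 'k^'n^'n. Y$k$k = 0})"
  then obtain k where T: "T = fill_column k ` {Y :: 'k^'n^'n. Y$k$k = 0}" by blast
  have "{Y :: 'k^'n^'n. Y$k$k = 0} \<subseteq> {Y. axis k (axis k 1) \<bullet> Y = 0}"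
    by (auto simp: inner_commute[of "axis k _"] inner_axis)
  then have "negligible {Y :: 'k^'n^'n. Y$k$k = 0}"
    using negligible_hyperplane[of "axis k (axis k 1)" 0] negligible_subset
    by (metis axis_eq_0_iff one_neq_zero)
  then show "negligible T"
    unfolding T by (rule negligible_differentiable_image_negligible[OF order_refl _ differentiable_on_fill_column])
qed simp

lemma AE_det_neq_0: "AE A in lborel. det (A :: 'k::{real_normed_field,euclidean_space}^'n^'n) \<noteq> 0"
proof (rule AE_I')
  have "{A :: 'k^'n^'n. det A = 0} \<in> null_sets lebesgue"
    using negligible_singular_matrices negligible_iff_null_sets by blast
  then show "{A :: 'k^'n^'n. det A = 0} \<in> null_sets lborel"
    by (subst (asm) null_sets_completion_iff) (auto intro: borel_closed closed_det_eq_0)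
qed auto

section \<open>Lebesgue measure is invariant under linear isometries\<close>

lemma nn_integral_lborel_translate:
  fixes c :: "'a::euclidean_space"
  assumes [measurable]: "f \<in> borel_measurable borel"
  shows "(\<integral>\<^sup>+x. f (c + x) \<partial>lborel) = (\<integral>\<^sup>+x. f x \<partial>lborel)"
proof -
  have "(\<integral>\<^sup>+x. f x \<partial>lborel) = (\<integral>\<^sup>+x. f x \<partial>distr lborel borel ((+) c))"
    by (simp add: lborel_distr_plus)
  also have "\<dots> = (\<integral>\<^sup>+x. f (c + x) \<partial>lborel)"
    by (rule nn_integral_distr) auto
  finally show ?thesis ..
qed

lemma borel_measurable_lborel_pair_continuous:
  fixes f :: "'a::euclidean_space \<times> 'b::euclidean_space \<Rightarrow> 'c::euclidean_space"
  assumes "continuous_on UNIV f"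
  shows "f \<in> borel_measurable (lborel \<Otimes>\<^sub>M lborel)"
proof -
  have "sets (lborel \<Otimes>\<^sub>M lborel) = sets ((borel :: 'a measure) \<Otimes>\<^sub>M (borel :: 'b measure))"
    by (rule sets_pair_measure_cong) simp_all
  also have "\<dots> = sets (borel :: ('a \<times> 'b) measure)"
    by (simp only: borel_prod)
  finally have eq: "sets (lborel \<Otimes>\<^sub>M lborel) = sets (borel :: ('a \<times> 'b) measure)" .
  show ?thesis
    unfolding measurable_cong_sets[OF eq refl] using assms by (rule borel_measurable_continuous_onI)
qed

lemma borel_measurable_linear:
  fixes T :: "'a::euclidean_space \<Rightarrow> 'b::euclidean_space"
  shows "linear T \<Longrightarrow> T \<in> borel_measurable borel"
  by (intro borel_measurable_continuous_onI linear_continuous_on) (simp add: linear_conv_bounded_linear)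

text \<open>Computing \<open>\<integral>\<integral> indicator A (T x) * indicator B (T x + y)\<close> in both orders needs only the
  translation invariance of Lebesgue measure; for \<open>A\<close> the unit ball this yields the invariance
  under isometries.\<close>

lemma lborel_shear_integral_y_first:
  fixes T :: "'a::euclidean_space \<Rightarrow> 'a"
  assumes [measurable]: "T \<in> borel_measurable borel" "A \<in> sets borel" "B \<in> sets borel"
  shows "(\<integral>\<^sup>+x. (\<integral>\<^sup>+y. indicator A (T x) * indicator B (T x + y) \<partial>lborel) \<partial>lborel)
    = emeasure lborel (T -` A) * emeasure lborel B"
proof -
  have "T -` A \<in> sets borel"
    using measurable_sets_borel[OF assms(1,2)] .
  have "(\<integral>\<^sup>+y. indicator A (T x) * indicator B (T x + y) \<partial>lborel) = indicator (T -` A) x * emeasure lborel B"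
    for x :: 'a
  proof -
    have "(\<integral>\<^sup>+y. indicator A (T x) * indicator B (T x + y) \<partial>lborel)
        = indicator A (T x) * (\<integral>\<^sup>+y. indicator B (T x + y) \<partial>lborel)"
      by (rule nn_integral_cmult) measurable
    also have "(\<integral>\<^sup>+y. indicator B (T x + y) \<partial>lborel) = emeasure lborel B"
      by (simp add: nn_integral_lborel_translate)
    finally show ?thesis by (simp add: indicator_def)
  qed
  then show ?thesis
    using \<open>T -` A \<in> sets borel\<close> by (simp add: nn_integral_multc nn_integral_indicator)
qed

lemma lborel_shear_integral_x_first:
  fixes T :: "'a::euclidean_space \<Rightarrow> 'a"
  assumes T: "linear T" and surj: "\<And>x. T (Ti x) = x"
    and A [measurable]: "A \<in> sets borel" and symm: "\<And>x. - x \<in> A \<longleftrightarrow> x \<in> A"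
    and B [measurable]: "B \<in> sets borel"
  shows "(\<integral>\<^sup>+y. (\<integral>\<^sup>+x. indicator A (T x) * indicator B (T x + y) \<partial>lborel) \<partial>lborel)
    = emeasure lborel A * emeasure lborel (T -` B)"
proof -
  have Tm [measurable]: "T \<in> borel_measurable borel"
    using T by (rule borel_measurable_linear)
  have "T -` B \<in> sets borel"
    using measurable_sets_borel[OF Tm B] .
  have [measurable]: "(\<lambda>z. T (snd z) - fst z) \<in> borel_measurable (lborel \<Otimes>\<^sub>M lborel)"
    using T by (intro borel_measurable_lborel_pair_continuous continuous_intros linear_continuous_on
        continuous_on_compose2[of UNIV T] bounded_linear_compose[OF _ bounded_linear_snd])
      (auto simp: linear_conv_bounded_linear)
  \<comment> \<open>substituting \<open>x \<mapsto> x + Ti (- y)\<close> turns \<open>T x + y\<close> into \<open>T x\<close>\<close>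
  have "(\<integral>\<^sup>+x. indicator A (T x) * indicator B (T x + y) \<partial>lborel)
      = (\<integral>\<^sup>+x. indicator A (T x - y) * indicator B (T x) \<partial>lborel)" for y
    using nn_integral_lborel_translate[of "\<lambda>x. indicator A (T x) * indicator B (T x + y)" "Ti (- y)"]
    by (simp add: linear_add[OF T] surj)
  then have "(\<integral>\<^sup>+y. (\<integral>\<^sup>+x. indicator A (T x) * indicator B (T x + y) \<partial>lborel) \<partial>lborel)
      = (\<integral>\<^sup>+x. (\<integral>\<^sup>+y. indicator A (T x - y) * indicator B (T x) \<partial>lborel) \<partial>lborel)"
    using lborel_pair.Fubini'[of "\<lambda>y x. indicator A (T x - y) * indicator B (T x) :: ennreal"]
    by (simp add: split_beta')
  also have "\<dots> = (\<integral>\<^sup>+x. emeasure lborel A * indicator (T -` B) x \<partial>lborel)"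
  proof (rule nn_integral_cong)
    fix x
    have "(\<integral>\<^sup>+y. indicator A (T x - y) * indicator B (T x) \<partial>lborel)
        = (\<integral>\<^sup>+y. indicator A (T x - y) \<partial>lborel) * indicator B (T x)"
      by (rule nn_integral_multc) measurable
    also have "(\<integral>\<^sup>+y. indicator A (T x - y) \<partial>lborel) = (\<integral>\<^sup>+y. indicator A (- T x + y) \<partial>lborel)"
      using symm[of "T x - _"] by (intro nn_integral_cong) (simp add: indicator_def)
    also have "\<dots> = emeasure lborel A"
      using nn_integral_lborel_translate[of "indicator A" "- T x"] by (simp add: nn_integral_indicator)
    finally show "(\<integral>\<^sup>+y. indicator A (T x - y) * indicator B (T x) \<partial>lborel) = emeasure lborel A * indicator (T -` B) x"
      by (simp add: indicator_def)
  qed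
  also have "\<dots> = emeasure lborel A * emeasure lborel (T -` B)"
    using \<open>T -` B \<in> sets borel\<close> by (simp add: nn_integral_cmult_indicator)
  finally show ?thesis .
qed

lemma lborel_linear_vimage_fubini:
  fixes T :: "'a::euclidean_space \<Rightarrow> 'a"
  assumes T: "linear T" and surj: "\<And>x. T (Ti x) = x"
    and A: "A \<in> sets borel" and symm: "\<And>x. - x \<in> A \<longleftrightarrow> x \<in> A" and B: "B \<in> sets borel"
  shows "emeasure lborel (T -` A) * emeasure lborel B = emeasure lborel A * emeasure lborel (T -` B)"
proof -
  have Tm: "T \<in> borel_measurable borel"
    using T by (rule borel_measurable_linear)
  have "(\<lambda>z. T (fst z) + snd z) \<in> borel_measurable (lborel \<Otimes>\<^sub>M lborel)"
    using T by (intro borel_measurable_lborel_pair_continuous continuous_intros linear_continuous_on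
        continuous_on_compose2[of UNIV T] bounded_linear_compose[OF _ bounded_linear_fst])
      (auto simp: linear_conv_bounded_linear)
  moreover have "(\<lambda>z. T (fst z)) \<in> borel_measurable (lborel \<Otimes>\<^sub>M lborel)"
    using Tm by simp
  ultimately have "(\<lambda>(x, y). indicator A (T x) * indicator B (T x + y) :: ennreal) \<in> borel_measurable (lborel \<Otimes>\<^sub>M lborel)"
    unfolding split_beta'
    by (intro borel_measurable_times_ennreal measurable_compose[OF _ borel_measurable_indicator[OF A]]
        measurable_compose[OF _ borel_measurable_indicator[OF B]])
  then show ?thesis
    using lborel_pair.Fubini'[of "\<lambda>x y. indicator A (T x) * indicator B (T x + y)"]
      lborel_shear_integral_y_first[OF Tm A B] lborel_shear_integral_x_first[OF T surj A symm B]
    by simp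
qed

lemma lborel_distr_linear_isometry:
  fixes T :: "'a::euclidean_space \<Rightarrow> 'a"
  assumes T: "linear T" and surj: "\<And>x. T (Ti x) = x" and iso: "\<And>x. norm (T x) = norm x"
  shows "distr lborel borel T = lborel"
proof (rule measure_eqI)
  fix B assume "B \<in> sets (distr lborel borel T)"
  then have B: "B \<in> sets borel" by simp
  have [measurable]: "T \<in> borel_measurable borel"
    using T by (rule borel_measurable_linear)
  let ?A = "ball (0::'a) 1"
  have vol: "emeasure lborel ?A = ennreal (unit_ball_vol (real DIM('a)))"
    using emeasure_ball[of 1 "0::'a"] by simp
  have "unit_ball_vol (real DIM('a)) > 0"
    by (rule unit_ball_vol_pos) simp
  then have A: "emeasure lborel ?A \<noteq> 0" "emeasure lborel ?A \<noteq> \<infinity>"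
    unfolding vol by (metis ennreal_eq_0_iff not_le) simp
  have "emeasure lborel ?A * emeasure lborel B = emeasure lborel ?A * emeasure lborel (T -` B)"
    using lborel_linear_vimage_fubini[OF T surj _ _ B, of ?A] iso by (simp add: vimage_def ball_def dist_norm)
  then have "emeasure lborel B = emeasure lborel (T -` B)"
    using A by (simp add: ennreal_mult_cancel_left)
  then show "emeasure (distr lborel borel T) B = emeasure lborel B"
    using B by (simp add: emeasure_distr)
qed simp

section \<open>Gaussian densities\<close>

definition gaussian_density :: "real \<Rightarrow> 'a::euclidean_space \<Rightarrow> real" where
  "gaussian_density \<sigma> x = (1 / sqrt (2 * pi * \<sigma>\<^sup>2)) ^ DIM('a) * exp (- (norm x)\<^sup>2 / (2 * \<sigma>\<^sup>2))"

definition gaussian :: "real \<Rightarrow> 'a::euclidean_space measure" where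
  "gaussian \<sigma> = density lborel (\<lambda>x. ennreal (gaussian_density \<sigma> x))"

lemma gaussian_density_eq_prod:
  "gaussian_density \<sigma> (x::'a::euclidean_space) = (\<Prod>b\<in>Basis. normal_density 0 \<sigma> (x \<bullet> b))"
proof -
  have "(norm x)\<^sup>2 = (\<Sum>b\<in>Basis. (x \<bullet> b)\<^sup>2)"
    unfolding power2_norm_eq_inner euclidean_inner[of x x] by (simp add: power2_eq_square)
  then have "(\<Prod>b\<in>Basis. exp (- (x \<bullet> b)\<^sup>2 / (2 * \<sigma>\<^sup>2))) = exp (- (norm x)\<^sup>2 / (2 * \<sigma>\<^sup>2))"
    by (simp add: exp_sum[symmetric] sum_divide_distrib sum_negf)
  then show ?thesis
    unfolding gaussian_density_def normal_density_def diff_zero prod.distrib by simp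
qed

lemma gaussian_density_pos: "\<sigma> > 0 \<Longrightarrow> gaussian_density \<sigma> x > 0"
  unfolding gaussian_density_def by simp

lemma borel_measurable_gaussian_density [measurable]:
  "gaussian_density \<sigma> \<in> borel_measurable (borel :: 'a::euclidean_space measure)"
  unfolding gaussian_density_def[abs_def] by measurable

lemma nn_integral_gaussian_density:
  assumes "\<sigma> > 0"
  shows "(\<integral>\<^sup>+x. ennreal (gaussian_density \<sigma> (x::'a::euclidean_space)) \<partial>lborel) = 1"
proof -
  have "(\<integral>\<^sup>+x. ennreal (gaussian_density \<sigma> (x::'a)) \<partial>lborel)
      = (\<integral>\<^sup>+x. (\<Prod>b\<in>Basis. ennreal (normal_density 0 \<sigma> ((x::'a) \<bullet> b))) \<partial>lborel)"
    by (simp add: gaussian_density_eq_prod prod_ennreal)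
  also have "\<dots> = (\<Prod>b\<in>(Basis::'a set). (\<integral>\<^sup>+t. ennreal (normal_density 0 \<sigma> t) \<partial>lborel))"
    by (rule nn_integral_lborel_prod) auto
  also have "(\<integral>\<^sup>+t. ennreal (normal_density 0 \<sigma> t) \<partial>lborel) = 1"
    using assms
    by (subst nn_integral_eq_integral) (auto simp: integrable_normal_density integral_normal_density)
  finally show ?thesis by simp
qed

lemma has_bochner_integral_gaussian_density_shift:
  assumes "\<sigma> > 0"
  shows "has_bochner_integral lborel (\<lambda>x. gaussian_density \<sigma> (x - v :: 'a::euclidean_space)) 1"
proof (rule has_bochner_integral_nn_integral)
  show "AE x in lborel. 0 \<le> gaussian_density \<sigma> (x - v)"
    by (intro AE_I2 less_imp_le gaussian_density_pos[OF assms])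
  show "(\<integral>\<^sup>+x. ennreal (gaussian_density \<sigma> (x - v)) \<partial>lborel) = ennreal 1"
    using nn_integral_lborel_translate[of "\<lambda>x. ennreal (gaussian_density \<sigma> x)" "- v"]
      nn_integral_gaussian_density[OF assms] by simp
qed simp_all

lemma gaussian_density_shift_power2:
  fixes x v :: "'a::euclidean_space"
  assumes "\<sigma> > 0"
  shows "(gaussian_density \<sigma> (x - v))\<^sup>2
    = exp ((norm v)\<^sup>2 / \<sigma>\<^sup>2) * gaussian_density \<sigma> (x - 2 *\<^sub>R v) * gaussian_density \<sigma> x"
proof -
  define K where "K = (1 / sqrt (2 * pi * \<sigma>\<^sup>2)) ^ DIM('a)"
  have e: "- 2 * (norm (x - v))\<^sup>2 = 2 * (norm v)\<^sup>2 - (norm (x - 2 *\<^sub>R v))\<^sup>2 - (norm x)\<^sup>2"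
    by (simp add: power2_norm_eq_inner inner_diff_left inner_diff_right inner_commute algebra_simps)
  have "(gaussian_density \<sigma> (x - v))\<^sup>2 = K * K * exp (- 2 * (norm (x - v))\<^sup>2 / (2 * \<sigma>\<^sup>2))"
    unfolding gaussian_density_def K_def by (simp add: power2_eq_square exp_add[symmetric] field_simps)
  also have "- 2 * (norm (x - v))\<^sup>2 / (2 * \<sigma>\<^sup>2)
      = (norm v)\<^sup>2 / \<sigma>\<^sup>2 + (- (norm (x - 2 *\<^sub>R v))\<^sup>2 / (2 * \<sigma>\<^sup>2)) + (- (norm x)\<^sup>2 / (2 * \<sigma>\<^sup>2))"
    unfolding e using assms by (simp add: field_simps)
  also have "K * K * exp \<dots>
      = exp ((norm v)\<^sup>2 / \<sigma>\<^sup>2) * gaussian_density \<sigma> (x - 2 *\<^sub>R v) * gaussian_density \<sigma> x"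
    unfolding gaussian_density_def K_def exp_add by simp
  finally show ?thesis .
qed

lemma abs_le_amgm:
  fixes d f t :: real
  assumes "f > 0" "t > 0"
  shows "\<bar>d\<bar> \<le> t / (2 * f) * d\<^sup>2 + f / (2 * t)"
proof -
  have "2 * t * f * \<bar>d\<bar> \<le> t\<^sup>2 * d\<^sup>2 + f\<^sup>2"
    using zero_le_power2[of "t * \<bar>d\<bar> - f"] by (simp add: power2_eq_square algebra_simps)
  then show ?thesis
    using assms by (simp add: field_simps power2_eq_square)
qed

text \<open>AM--GM bounds \<open>\<bar>g - f\<bar>\<close> by a combination of \<open>f\<close>, \<open>g\<close> and \<open>g\<^sup>2 / f\<close>, and for
  Gaussians \<open>g\<^sup>2 / f\<close> is again a Gaussian, up to the factor \<open>exp (\<bar>v\<bar>\<^sup>2 / \<sigma>\<^sup>2)\<close>.\<close>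

lemma gaussian_density_shift_diff_le:
  fixes x v :: "'a::euclidean_space"
  assumes "\<sigma> > 0" "t > 0"
  shows "\<bar>gaussian_density \<sigma> (x - v) - gaussian_density \<sigma> x\<bar>
    \<le> t * exp ((norm v)\<^sup>2 / \<sigma>\<^sup>2) / 2 * gaussian_density \<sigma> (x - 2 *\<^sub>R v)
      - t * gaussian_density \<sigma> (x - v) + (t / 2 + 1 / (2 * t)) * gaussian_density \<sigma> x"
proof -
  let ?f = "gaussian_density \<sigma> x" and ?g = "gaussian_density \<sigma> (x - v)"
  have f: "?f > 0" by (rule gaussian_density_pos[OF assms(1)])
  have "\<bar>?g - ?f\<bar> \<le> t / (2 * ?f) * (?g - ?f)\<^sup>2 + ?f / (2 * t)"
    by (rule abs_le_amgm[OF f assms(2)])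
  also have "t / (2 * ?f) * (?g - ?f)\<^sup>2 = t / (2 * ?f) * ?g\<^sup>2 - t * ?g + t / 2 * ?f"
    using f by (simp add: power2_diff field_simps power2_eq_square)
  also have "t / (2 * ?f) * ?g\<^sup>2 = t * exp ((norm v)\<^sup>2 / \<sigma>\<^sup>2) / 2 * gaussian_density \<sigma> (x - 2 *\<^sub>R v)"
    unfolding gaussian_density_shift_power2[OF assms(1)] using f by (simp add: field_simps)
  finally show ?thesis by (simp add: algebra_simps)
qed

lemma exp_power2_le:
  fixes u :: real
  assumes "0 \<le> u" "u \<le> 1"
  shows "exp (u\<^sup>2) \<le> 1 + 2 * u\<^sup>2"
proof -
  have "u\<^sup>2 \<le> 1" using assms by (simp add: power_le_one)
  then have "exp (u\<^sup>2) \<le> 1 + u\<^sup>2 + (u\<^sup>2)\<^sup>2" by (intro exp_bound) simp_all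
  moreover have "(u\<^sup>2)\<^sup>2 \<le> u\<^sup>2"
    using mult_left_le[OF \<open>u\<^sup>2 \<le> 1\<close>, of "u\<^sup>2"] by (simp add: power2_eq_square)
  ultimately show ?thesis by simp
qed

lemma gaussian_density_shift_L1:
  fixes v :: "'a::euclidean_space"
  assumes \<sigma>: "\<sigma> > 0" and v: "norm v \<le> \<sigma>"
  shows "integrable lborel (\<lambda>x. \<bar>gaussian_density \<sigma> (x - v) - gaussian_density \<sigma> x\<bar>)"
    and "(\<integral>x. \<bar>gaussian_density \<sigma> (x - v) - gaussian_density \<sigma> x\<bar> \<partial>lborel) \<le> 3 / (2 * \<sigma>) * norm v"
proof -
  have hb: "has_bochner_integral lborel (\<lambda>x. gaussian_density \<sigma> (x - w)) 1" for w :: 'a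
    by (rule has_bochner_integral_gaussian_density_shift[OF \<sigma>])
  show int: "integrable lborel (\<lambda>x. \<bar>gaussian_density \<sigma> (x - v) - gaussian_density \<sigma> x\<bar>)"
    using hb[of v] hb[of 0] by (intro integrable_abs integrable_diff) (auto simp: has_bochner_integral_iff)
  show "(\<integral>x. \<bar>gaussian_density \<sigma> (x - v) - gaussian_density \<sigma> x\<bar> \<partial>lborel) \<le> 3 / (2 * \<sigma>) * norm v"
  proof (cases "v = 0")
    case False
    define u where "u = norm v / \<sigma>"
    have u: "0 < u" "u \<le> 1" using False \<sigma> v by (auto simp: u_def)
    define E where "E = exp ((norm v)\<^sup>2 / \<sigma>\<^sup>2)"
    have E: "E \<le> 1 + 2 * u\<^sup>2"
      unfolding E_def using exp_power2_le[of u] u by (simp add: u_def power_divide)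
    \<comment> \<open>this choice of \<open>t\<close> balances the two terms of the AM--GM bound\<close>
    define t where "t = 1 / u"
    have t: "t > 0" using u by (simp add: t_def)
    define r where "r x = t * E / 2 * gaussian_density \<sigma> (x - 2 *\<^sub>R v)
      - t * gaussian_density \<sigma> (x - v) + (t / 2 + 1 / (2 * t)) * gaussian_density \<sigma> (x - 0)" for x
    have r: "has_bochner_integral lborel r (t * E / 2 * 1 - t * 1 + (t / 2 + 1 / (2 * t)) * 1)"
      unfolding r_def
      by (intro has_bochner_integral_add has_bochner_integral_diff has_bochner_integral_mult_right hb)
    have "(\<integral>x. \<bar>gaussian_density \<sigma> (x - v) - gaussian_density \<sigma> x\<bar> \<partial>lborel) \<le> integral\<^sup>L lborel r"
      using int r gaussian_density_shift_diff_le[OF \<sigma> t]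
      by (intro integral_mono) (auto simp: has_bochner_integral_iff r_def E_def)
    also have "\<dots> = t * (E - 1) / 2 + 1 / (2 * t)"
      using has_bochner_integral_integral_eq[OF r] by (simp add: field_simps)
    also have "\<dots> = (E - 1) / (2 * u) + u / 2"
      using u by (simp add: t_def field_simps)
    also have "\<dots> \<le> u + u / 2"
      using E u by (simp add: field_simps power2_eq_square)
    also have "\<dots> = 3 / (2 * \<sigma>) * norm v"
      using \<sigma> by (simp add: u_def field_simps)
    finally show ?thesis .
  qed simp
qed

section \<open>The Q factor of a Gaussian matrix is Haar distributed\<close>

context conjugation
begin

lemma hinner_matrix_vector_mult: "hinner u (A *v v) = hinner (conj_transpose A *v u) v"
proof -
  have "hinner u (A *v v) = (\<Sum>i\<in>UNIV. \<Sum>k\<in>UNIV. cj (u$i) * (A$i$k * v$k))"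
    unfolding hinner_def matrix_vector_mult_def by (simp add: sum_distrib_left)
  also have "\<dots> = (\<Sum>k\<in>UNIV. \<Sum>i\<in>UNIV. cj (u$i) * (A$i$k * v$k))"
    by (rule sum.swap)
  also have "\<dots> = hinner (conj_transpose A *v u) v"
    unfolding hinner_def matrix_vector_mult_def conj_transpose_def
    by (simp add: cj_sum cj_mult sum_distrib_left sum_distrib_right mult_ac)
  finally show ?thesis .
qed

lemma norm_unitary_mult_vec:
  assumes "unitary U"
  shows "norm (U *v v) = norm v"
proof -
  have "hinner (U *v v) (U *v v) = hinner v v"
    using assms unfolding unitary_iff_left_inverse by (simp add: hinner_matrix_vector_mult matrix_vector_mul_assoc)
  then have "(norm (U *v v))\<^sup>2 = (norm v)\<^sup>2"
    by (simp only: hinner_self of_real_eq_iff)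
  then show ?thesis by (simp add: power2_eq_iff_nonneg)
qed

lemma norm_unitary_mult:
  assumes "unitary U"
  shows "norm (U ** X) = norm X"
proof -
  have "(norm (U ** X))\<^sup>2 = (norm X)\<^sup>2"
    by (simp add: norm_power2_columns column_matrix_mult_left norm_unitary_mult_vec[OF assms])
  then show ?thesis by (simp add: power2_eq_iff_nonneg)
qed

end

context euclidean_conjugation
begin

lemma lborel_distr_unitary_mult:
  assumes "unitary U"
  shows "distr lborel borel (\<lambda>X::'k^'n^'n. U ** X) = lborel"
  using assms
  by (intro lborel_distr_linear_isometry[where Ti = "\<lambda>X. conj_transpose U ** X"] linear_matrix_mult_left)
    (simp_all add: unitary_def matrix_mul_assoc norm_unitary_mult)

lemma gaussian_density_unitary_mult: "unitary U \<Longrightarrow> gaussian_density \<sigma> (U ** X) = gaussian_density \<sigma> X"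
  by (simp add: gaussian_density_def norm_unitary_mult)

lemma nn_integral_gaussian_qr_Q_unitary_mult:
  fixes U :: "'k^('n::{finite,linorder})^('n::{finite,linorder})"
  assumes U: "unitary U" and [measurable]: "B \<in> sets borel"
  shows "(\<integral>\<^sup>+X. ennreal (gaussian_density \<sigma> X) * indicator B (qr_Q X) \<partial>lborel)
    = (\<integral>\<^sup>+X. ennreal (gaussian_density \<sigma> X) * indicator B (U ** qr_Q X) \<partial>lborel)"
proof -
  have [measurable]: "(\<lambda>X. U ** X) \<in> borel_measurable (borel :: ('k^('n::{finite,linorder})^('n::{finite,linorder})) measure)"
    by (intro borel_measurable_continuous_onI continuous_intros)
  have "(\<integral>\<^sup>+X. ennreal (gaussian_density \<sigma> X) * indicator B (qr_Q X) \<partial>lborel)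
      = (\<integral>\<^sup>+X. ennreal (gaussian_density \<sigma> X) * indicator B (qr_Q X) \<partial>distr lborel borel ((**) U))"
    by (simp add: lborel_distr_unitary_mult[OF U])
  also have "\<dots> = (\<integral>\<^sup>+X. ennreal (gaussian_density \<sigma> (U ** X)) * indicator B (qr_Q (U ** X)) \<partial>lborel)"
    by (rule nn_integral_distr) measurable
  also have "\<dots> = (\<integral>\<^sup>+X. ennreal (gaussian_density \<sigma> X) * indicator B (U ** qr_Q X) \<partial>lborel)"
  proof (rule nn_integral_cong_AE)
    show "AE X in lborel. ennreal (gaussian_density \<sigma> (U ** X)) * indicator B (qr_Q (U ** X))
        = ennreal (gaussian_density \<sigma> X) * indicator B (U ** qr_Q X)"
      using AE_det_neq_0
      by eventually_elim (simp add: qr_Q_unitary_mult[OF U] gaussian_density_unitary_mult[OF U])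
  qed
  finally show ?thesis .
qed

lemma borel_measurable_mult_qr_Q_pair:
  fixes H :: "('k^('n::{finite,linorder})^('n::{finite,linorder})) measure"
  assumes "sets H = sets borel"
  shows "(\<lambda>z. snd z ** qr_Q (fst z)) \<in> borel_measurable (lborel \<Otimes>\<^sub>M H)"
proof -
  have mult: "(\<lambda>z. fst z ** snd z) \<in> borel_measurable (borel \<Otimes>\<^sub>M (borel :: ('k^('n::{finite,linorder})^('n::{finite,linorder})) measure))"
    by (subst borel_prod) (intro borel_measurable_continuous_onI continuous_intros)
  have eq: "sets (lborel \<Otimes>\<^sub>M H) = sets (borel \<Otimes>\<^sub>M (borel :: ('k^('n::{finite,linorder})^('n::{finite,linorder})) measure))"
    using assms by (intro sets_pair_measure_cong) simp_all
  have "(\<lambda>z. (snd z, qr_Q (fst z))) \<in> borel \<Otimes>\<^sub>M borel \<rightarrow>\<^sub>M borel \<Otimes>\<^sub>M (borel :: ('k^('n::{finite,linorder})^('n::{finite,linorder})) measure)"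
    by measurable
  from measurable_compose[OF this mult] show ?thesis
    unfolding measurable_cong_sets[OF eq refl] by simp
qed

lemma nn_integral_haar_mult_right:
  fixes H :: "('k^('n::{finite,linorder})^('n::{finite,linorder})) measure"
  assumes H: "haar H" and Q: "unitary Q" and B: "B \<in> sets borel"
  shows "(\<integral>\<^sup>+U. indicator B (U ** Q) \<partial>H) = emeasure H B"
proof -
  have Hs: "sets H = sets borel"
    using H unfolding haar_def by blast
  have "(\<lambda>U. U ** Q) \<in> borel_measurable borel"
    by (intro borel_measurable_continuous_onI continuous_intros)
  then have mQ: "(\<lambda>U. U ** Q) \<in> H \<rightarrow>\<^sub>M H"
    by (simp add: measurable_cong_sets[OF Hs refl] measurable_cong_sets[OF refl Hs])
  have "(\<integral>\<^sup>+U. indicator B (U ** Q) \<partial>H) = (\<integral>\<^sup>+U. indicator B U \<partial>distr H H (\<lambda>U. U ** Q))"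
    by (rule nn_integral_distr[symmetric, OF mQ borel_measurable_indicator]) (simp add: B Hs)
  also have "\<dots> = emeasure H B"
    using H Q B unfolding haar_def by simp
  finally show ?thesis .
qed

text \<open>Averaging \<open>nn_integral_gaussian_qr_Q_unitary_mult\<close> over \<open>U\<close> distributed according
  to \<open>H\<close> and exchanging the integrals, the right invariance of \<open>H\<close> turns the inner integral
  into \<open>H B\<close>.\<close>

lemma distr_gaussian_qr_Q_eq_haar:
  fixes H :: "('k^('n::{finite,linorder})^('n::{finite,linorder})) measure"
  assumes \<sigma>: "\<sigma> > 0" and H: "haar H"
  shows "distr (gaussian \<sigma>) borel qr_Q = H"
proof (rule measure_eqI)
  have Hs: "sets H = sets borel" and "prob_space H" and Hu: "measure H {Q. unitary Q} = 1"
    using H unfolding haar_def by auto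
  interpret H: prob_space H by fact
  show "sets (distr (gaussian \<sigma>) borel qr_Q) = sets H" using Hs by simp
  fix B :: "('k^('n::{finite,linorder})^('n::{finite,linorder})) set" assume "B \<in> sets (distr (gaussian \<sigma>) borel qr_Q)"
  then have B [measurable]: "B \<in> sets borel" by simp
  have [measurable]: "(\<lambda>z. snd z ** qr_Q (fst z)) \<in> borel_measurable (lborel \<Otimes>\<^sub>M H)"
    using Hs by (rule borel_measurable_mult_qr_Q_pair)
  define f where "f X = ennreal (gaussian_density \<sigma> X)" for X :: "('k^('n::{finite,linorder})^('n::{finite,linorder}))"
  define P where "P = (\<integral>\<^sup>+X. f X * indicator B (qr_Q X) \<partial>lborel)"
  have "P = (\<integral>\<^sup>+U. P \<partial>H)"
    by (simp add: H.emeasure_space_1)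
  also have "\<dots> = (\<integral>\<^sup>+U. (\<integral>\<^sup>+X. f X * indicator B (U ** qr_Q X) \<partial>lborel) \<partial>H)"
    using H.AE_prob_1[OF Hu]
    by (intro nn_integral_cong_AE) (auto simp: P_def f_def nn_integral_gaussian_qr_Q_unitary_mult elim: AE_mp)
  also have "\<dots> = (\<integral>\<^sup>+X. (\<integral>\<^sup>+U. f X * indicator B (U ** qr_Q X) \<partial>H) \<partial>lborel)"
    by (rule pair_sigma_finite.Fubini'[of lborel H "\<lambda>X U. f X * indicator B (U ** qr_Q X)"])
      (auto intro: pair_sigma_finite.intro sigma_finite_lborel H.sigma_finite_measure_axioms
        simp: f_def split_beta')
  also have "\<dots> = (\<integral>\<^sup>+X. f X * emeasure H B \<partial>lborel)"
  proof (rule nn_integral_cong_AE[OF eventually_mono[OF AE_det_neq_0]])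
    fix X :: "('k^('n::{finite,linorder})^('n::{finite,linorder}))" assume "det X \<noteq> 0"
    then have "unitary (qr_Q X)" by (metis qr_Q_decomposition)
    moreover have "(\<lambda>U. U ** qr_Q X) \<in> borel_measurable H"
      unfolding measurable_cong_sets[OF Hs refl] by (intro borel_measurable_continuous_onI continuous_intros)
    ultimately show "(\<integral>\<^sup>+U. f X * indicator B (U ** qr_Q X) \<partial>H) = f X * emeasure H B"
      by (simp add: nn_integral_cmult nn_integral_haar_mult_right[OF H])
  qed
  also have "\<dots> = emeasure H B"
    by (simp add: f_def nn_integral_multc nn_integral_gaussian_density[OF \<sigma>])
  finally have "P = emeasure H B" .
  moreover have "qr_Q -` B \<in> sets lborel"
    using measurable_sets_borel[OF qr_Q_measurable B] by simp
  then have "emeasure (distr (gaussian \<sigma>) borel qr_Q) B = P"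
    by (simp add: P_def f_def gaussian_def emeasure_distr emeasure_density indicator_vimage)
  ultimately show "emeasure (distr (gaussian \<sigma>) borel qr_Q) B = emeasure H B"
    by simp
qed

end

section \<open>Total variation bound\<close>

lemma measure_distr_density_eq_integral:
  fixes f :: "'a::euclidean_space \<Rightarrow> real" and \<phi> :: "'a \<Rightarrow> 'b::topological_space"
  assumes [measurable]: "\<phi> \<in> borel_measurable borel" "A \<in> sets borel"
    and f: "integrable lborel f" "\<And>x. 0 \<le> f x"
  shows "measure (distr (density lborel (\<lambda>x. ennreal (f x))) borel \<phi>) A = (\<integral>x. f x * indicator A (\<phi> x) \<partial>lborel)"
proof -
  have [measurable]: "f \<in> borel_measurable borel"
    using borel_measurable_integrable[OF f(1)] by simp
  have pre: "\<phi> -` A \<in> sets lborel"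
    using measurable_sets_borel[of \<phi> borel A] by simp
  have int: "integrable lborel (\<lambda>x. f x * indicator A (\<phi> x))"
    using integrable_mult_indicator[OF pre f(1)] by (simp add: indicator_vimage mult.commute)
  have "emeasure (distr (density lborel (\<lambda>x. ennreal (f x))) borel \<phi>) A
      = (\<integral>\<^sup>+x. ennreal (f x * indicator A (\<phi> x)) \<partial>lborel)"
    using pre by (simp add: emeasure_distr emeasure_density indicator_vimage ennreal_mult' f(2) ennreal_indicator)
  also have "\<dots> = ennreal (\<integral>x. f x * indicator A (\<phi> x) \<partial>lborel)"
    using int f(2) by (intro nn_integral_eq_integral) auto
  finally show ?thesis
    using f(2) by (simp add: measure_def integral_nonneg)
qed

lemma tv_dist_distr_density_le:
  fixes f g :: "'a::euclidean_space \<Rightarrow> real" and \<phi> :: "'a \<Rightarrow> 'b::topological_space"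
  assumes \<phi>: "\<phi> \<in> borel_measurable borel"
    and f: "integrable lborel f" "\<And>x. 0 \<le> f x" and g: "integrable lborel g" "\<And>x. 0 \<le> g x"
  shows "tv_dist (distr (density lborel (\<lambda>x. ennreal (f x))) borel \<phi>) (distr (density lborel (\<lambda>x. ennreal (g x))) borel \<phi>)
    \<le> (\<integral>x. \<bar>f x - g x\<bar> \<partial>lborel)"
  unfolding tv_dist_def
proof (rule cSUP_least)
  show "sets (distr (density lborel (\<lambda>x. ennreal (f x))) borel \<phi>) \<noteq> {}"
    using sets.empty_sets by blast
  fix A assume "A \<in> sets (distr (density lborel (\<lambda>x. ennreal (f x))) borel \<phi>)"
  then have A: "A \<in> sets borel" by simp
  have pre: "\<phi> -` A \<in> sets lborel"
    using measurable_sets_borel[OF \<phi> A] by simp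
  have int: "integrable lborel (\<lambda>x. h x * indicator A (\<phi> x))" if "integrable lborel h" for h :: "'a \<Rightarrow> real"
    using integrable_mult_indicator[OF pre that] by (simp add: indicator_vimage mult.commute)
  have "measure (distr (density lborel (\<lambda>x. ennreal (f x))) borel \<phi>) A
      - measure (distr (density lborel (\<lambda>x. ennreal (g x))) borel \<phi>) A
      = (\<integral>x. (f x - g x) * indicator A (\<phi> x) \<partial>lborel)"
    using int[OF f(1)] int[OF g(1)]
    by (simp add: measure_distr_density_eq_integral[OF \<phi> A] f g left_diff_distrib)
  also have "\<bar>\<dots>\<bar> \<le> (\<integral>x. \<bar>f x - g x\<bar> \<partial>lborel)"
    using int[of "\<lambda>x. f x - g x"] f(1) g(1)
    by (intro integral_abs_bound_integral) (auto simp: indicator_def abs_mult)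
  finally show "\<bar>measure (distr (density lborel (\<lambda>x. ennreal (f x))) borel \<phi>) A
      - measure (distr (density lborel (\<lambda>x. ennreal (g x))) borel \<phi>) A\<bar> \<le> (\<integral>x. \<bar>f x - g x\<bar> \<partial>lborel)" .
qed

lemma distr_density_lborel_translate:
  fixes f :: "'a::euclidean_space \<Rightarrow> ennreal"
  assumes [measurable]: "f \<in> borel_measurable borel"
  shows "distr (density lborel f) borel (\<lambda>x. x + c) = density lborel (\<lambda>x. f (x - c))"
proof (rule measure_eqI)
  fix A assume "A \<in> sets (distr (density lborel f) borel (\<lambda>x. x + c))"
  then have [measurable]: "A \<in> sets borel" by simp
  have "(\<lambda>x. x + c) -` A \<in> sets lborel"
    using measurable_sets_borel[of "\<lambda>x. x + c" borel A] by simp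
  then have "emeasure (distr (density lborel f) borel (\<lambda>x. x + c)) A
      = (\<integral>\<^sup>+x. f x * indicator ((\<lambda>x. x + c) -` A) x \<partial>lborel)"
    by (simp add: emeasure_distr emeasure_density)
  also have "\<dots> = (\<integral>\<^sup>+x. f x * indicator A (x + c) \<partial>lborel)"
    by (simp only: indicator_vimage)
  also have "\<dots> = (\<integral>\<^sup>+x. f (x - c) * indicator A x \<partial>lborel)"
    using nn_integral_lborel_translate[of "\<lambda>x. f (x - c) * indicator A x" c] by (simp add: add.commute)
  also have "\<dots> = emeasure (density lborel (\<lambda>x. f (x - c))) A"
    by (simp add: emeasure_density)
  finally show "emeasure (distr (density lborel f) borel (\<lambda>x. x + c)) A = emeasure (density lborel (\<lambda>x. f (x - c))) A" .
qed simp

context euclidean_conjugation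
begin

lemma distr_gaussian_qr_Q_perturbed:
  fixes \<theta> :: real
  assumes "\<theta> < 1"
  shows "distr (gaussian \<sigma>) borel (\<lambda>X::'k^('n::{finite,linorder})^('n::{finite,linorder}). qr_Q ((1 - \<theta>) *\<^sub>R X + \<theta> *\<^sub>R mat 1))
    = distr (density lborel (\<lambda>X. ennreal (gaussian_density \<sigma> (X - (\<theta> / (1 - \<theta>)) *\<^sub>R mat 1)))) borel qr_Q"
proof -
  define w where "w = (\<theta> / (1 - \<theta>)) *\<^sub>R (mat 1 :: 'k^('n::{finite,linorder})^('n::{finite,linorder}))"
  have "(1 - \<theta>) *\<^sub>R X + \<theta> *\<^sub>R mat 1 = (1 - \<theta>) *\<^sub>R (X + w)" for X :: "'k^('n::{finite,linorder})^('n::{finite,linorder})"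
    using assms by (simp add: w_def scaleR_add_right)
  then have "(\<lambda>X. qr_Q ((1 - \<theta>) *\<^sub>R X + \<theta> *\<^sub>R mat 1)) = qr_Q \<circ> (\<lambda>X. X + w)"
    using assms by (simp add: qr_Q_scaleR comp_def)
  then have "distr (gaussian \<sigma>) borel (\<lambda>X. qr_Q ((1 - \<theta>) *\<^sub>R X + \<theta> *\<^sub>R mat 1))
      = distr (distr (gaussian \<sigma>) borel (\<lambda>X. X + w)) borel qr_Q"
    by (simp add: distr_distr gaussian_def)
  also have "distr (gaussian \<sigma>) borel (\<lambda>X. X + w) = density lborel (\<lambda>X. ennreal (gaussian_density \<sigma> (X - w)))"
    unfolding gaussian_def by (rule distr_density_lborel_translate) simp
  finally show ?thesis by (simp add: w_def)
qed

lemma tv_dist_qr_Q_perturbed_gaussian_le: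
  fixes H :: "('k^('n::{finite,linorder})^('n::{finite,linorder})) measure"
  assumes \<sigma>: "\<sigma> > 0" and H: "haar H" and \<theta>: "0 \<le> \<theta>" "\<theta> < 1 / 2" "2 * \<theta> * norm (mat 1 :: 'k^('n::{finite,linorder})^('n::{finite,linorder})) \<le> \<sigma>"
  shows "tv_dist (distr (gaussian \<sigma>) borel (\<lambda>X. qr_Q ((1 - \<theta>) *\<^sub>R X + \<theta> *\<^sub>R mat 1))) H
    \<le> 3 * norm (mat 1 :: 'k^('n::{finite,linorder})^('n::{finite,linorder})) / \<sigma> * \<theta>"
proof -
  define w where "w = (\<theta> / (1 - \<theta>)) *\<^sub>R (mat 1 :: 'k^('n::{finite,linorder})^('n::{finite,linorder}))"
  have "\<theta> \<le> 2 * \<theta> * (1 - \<theta>)"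
    using \<theta> mult_nonneg_nonneg[of \<theta> "1 - 2 * \<theta>"] by (simp add: algebra_simps)
  then have "\<theta> / (1 - \<theta>) \<le> 2 * \<theta>"
    using \<theta> by (simp add: pos_divide_le_eq)
  moreover have "norm w = \<theta> / (1 - \<theta>) * norm (mat 1 :: 'k^('n::{finite,linorder})^('n::{finite,linorder}))"
    using \<theta> by (simp add: w_def)
  ultimately have w: "norm w \<le> 2 * \<theta> * norm (mat 1 :: 'k^('n::{finite,linorder})^('n::{finite,linorder}))"
    by (metis mult_right_mono norm_ge_zero)
  have dens: "integrable lborel (\<lambda>X. gaussian_density \<sigma> (X - v))" "0 \<le> gaussian_density \<sigma> (X - v)"
    for v X :: "'k^('n::{finite,linorder})^('n::{finite,linorder})"
    using has_bochner_integral_gaussian_density_shift[OF \<sigma>, of v] gaussian_density_pos[OF \<sigma>, of "X - v"]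
    by (auto simp: has_bochner_integral_iff)
  have "tv_dist (distr (gaussian \<sigma>) borel (\<lambda>X. qr_Q ((1 - \<theta>) *\<^sub>R X + \<theta> *\<^sub>R mat 1))) H
      = tv_dist (distr (density lborel (\<lambda>X. ennreal (gaussian_density \<sigma> (X - w)))) borel qr_Q)
          (distr (density lborel (\<lambda>X. ennreal (gaussian_density \<sigma> (X - 0)))) borel qr_Q)"
  proof -
    have "distr (gaussian \<sigma>) borel (\<lambda>X. qr_Q ((1 - \<theta>) *\<^sub>R X + \<theta> *\<^sub>R mat 1))
        = distr (density lborel (\<lambda>X. ennreal (gaussian_density \<sigma> (X - w)))) borel qr_Q"
      unfolding w_def using \<theta> by (intro distr_gaussian_qr_Q_perturbed) simp
    moreover have "H = distr (density lborel (\<lambda>X. ennreal (gaussian_density \<sigma> (X - 0)))) borel qr_Q"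
      using distr_gaussian_qr_Q_eq_haar[OF \<sigma> H] by (simp add: gaussian_def)
    ultimately show ?thesis by (simp only:)
  qed
  also have "\<dots> \<le> (\<integral>X. \<bar>gaussian_density \<sigma> (X - w) - gaussian_density \<sigma> (X - 0)\<bar> \<partial>lborel)"
    by (intro tv_dist_distr_density_le qr_Q_measurable dens)
  also have "\<dots> \<le> 3 / (2 * \<sigma>) * norm w"
    using gaussian_density_shift_L1(2)[OF \<sigma>, of w] w \<theta>(3) by simp
  also have "\<dots> \<le> 3 * norm (mat 1 :: 'k^('n::{finite,linorder})^('n::{finite,linorder})) / \<sigma> * \<theta>"
    using w \<sigma> by (simp add: field_simps)
  finally show ?thesis .
qed

theorem tv_dist_qr_Q_perturbed_gaussian_haar:
  assumes \<sigma>: "\<sigma> > 0"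
  shows "\<exists>C \<delta>. \<delta> > 0 \<and> (\<forall>H :: ('k^('n::{finite,linorder})^('n::{finite,linorder})) measure. haar H \<longrightarrow> (\<forall>\<theta>. 0 \<le> \<theta> \<and> \<theta> < \<delta> \<longrightarrow>
    tv_dist (distr (gaussian \<sigma>) borel (\<lambda>X. qr_Q ((1 - \<theta>) *\<^sub>R X + \<theta> *\<^sub>R mat 1))) H \<le> C * \<theta>))"
proof -
  define I where "I = norm (mat 1 :: 'k^('n::{finite,linorder})^('n::{finite,linorder}))"
  have "I > 0" unfolding I_def by (simp add: vec_eq_iff mat_def)
  moreover have "2 * \<theta> * I \<le> \<sigma>" if "\<theta> < \<sigma> / (2 * I)" for \<theta>
    using that \<open>I > 0\<close> by (simp add: field_simps)
  ultimately have "\<forall>H :: ('k^('n::{finite,linorder})^('n::{finite,linorder})) measure. haar H \<longrightarrow> (\<forall>\<theta>. 0 \<le> \<theta> \<and> \<theta> < min (1 / 2) (\<sigma> / (2 * I)) \<longrightarrow>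
      tv_dist (distr (gaussian \<sigma>) borel (\<lambda>X. qr_Q ((1 - \<theta>) *\<^sub>R X + \<theta> *\<^sub>R mat 1))) H \<le> 3 * I / \<sigma> * \<theta>)"
    using tv_dist_qr_Q_perturbed_gaussian_le[OF \<sigma>] by (auto simp: I_def)
  moreover have "min (1 / 2) (\<sigma> / (2 * I)) > 0"
    using \<sigma> \<open>I > 0\<close> by simp
  ultimately show ?thesis by blast
qed

end

section \<open>The real and the complex case\<close>

lemma euclidean_conjugation_id: "euclidean_conjugation (id :: real \<Rightarrow> real)"
  by unfold_locales (simp_all add: power2_eq_square continuous_on_id)

lemma euclidean_conjugation_cnj: "euclidean_conjugation cnj"
  by unfold_locales
    (auto simp: complex_norm_square mult.commute simp del: of_real_power
      intro: linear_continuous_on bounded_linear_cnj)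

lemma unitary_id_eq: "conjugation.unitary (id :: real \<Rightarrow> real) = (orthogonal_matrix :: real^'n^'n \<Rightarrow> bool)"
proof -
  interpret euclidean_conjugation "id :: real \<Rightarrow> real" by (rule euclidean_conjugation_id)
  show ?thesis
    by (simp add: fun_eq_iff unitary_def conj_transpose_def orthogonal_matrix_def transpose_def)
qed

lemma unitary_cnj_eq: "conjugation.unitary cnj = (unitary_matrix :: complex^'n^'n \<Rightarrow> bool)"
proof -
  interpret euclidean_conjugation cnj by (rule euclidean_conjugation_cnj)
  show ?thesis
    by (simp add: fun_eq_iff unitary_def conj_transpose_def unitary_matrix_def cnj_transpose_def)
qed

lemma qr_Q_real_eq: "qr_Q_real = (conjugation.qr_Q id :: real^('n::{finite,linorder})^('n::{finite,linorder}) \<Rightarrow> _)"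
proof -
  interpret euclidean_conjugation "id :: real \<Rightarrow> real" by (rule euclidean_conjugation_id)
  have "positive_diagonal R \<longleftrightarrow> (\<forall>i. R $ i $ i > 0)" for R :: "real^('n::{finite,linorder})^('n::{finite,linorder})"
    unfolding positive_diagonal_def by auto
  then show ?thesis
    by (simp add: fun_eq_iff qr_Q_real_def qr_Q_def unitary_id_eq)
qed

lemma qr_Q_complex_eq: "qr_Q_complex = (conjugation.qr_Q cnj :: complex^('n::{finite,linorder})^('n::{finite,linorder}) \<Rightarrow> _)"
proof -
  interpret euclidean_conjugation cnj by (rule euclidean_conjugation_cnj)
  have "(\<exists>r>0. z = complex_of_real r) \<longleftrightarrow> Im z = 0 \<and> Re z > 0" for z
    by (auto simp: complex_eq_iff intro: exI[of _ "Re z"])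
  then have "positive_diagonal R \<longleftrightarrow> (\<forall>i. Im (R $ i $ i) = 0 \<and> Re (R $ i $ i) > 0)"
    for R :: "complex^('n::{finite,linorder})^('n::{finite,linorder})"
    unfolding positive_diagonal_def by auto
  then show ?thesis
    by (simp add: fun_eq_iff qr_Q_complex_def qr_Q_def unitary_cnj_eq)
qed

lemma haar_orthogonal_eq: "haar_orthogonal = conjugation.haar (id :: real \<Rightarrow> real)"
proof -
  interpret euclidean_conjugation "id :: real \<Rightarrow> real" by (rule euclidean_conjugation_id)
  show ?thesis by (simp add: fun_eq_iff haar_orthogonal_def haar_def unitary_id_eq)
qed

lemma haar_unitary_eq: "haar_unitary = conjugation.haar cnj"
proof -
  interpret euclidean_conjugation cnj by (rule euclidean_conjugation_cnj)
  show ?thesis by (simp add: fun_eq_iff haar_unitary_def haar_def unitary_cnj_eq)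
qed

lemma prod_prod_const_mult_exp:
  fixes a :: "'n::finite \<Rightarrow> 'n \<Rightarrow> real"
  shows "(\<Prod>i\<in>UNIV. \<Prod>j\<in>UNIV. c * exp (a i j)) = c ^ (CARD('n) * CARD('n)) * exp (\<Sum>i\<in>UNIV. \<Sum>j\<in>UNIV. a i j)"
  by (simp add: prod.distrib exp_sum power_mult)

lemma real_ginibre_eq_gaussian: "real_ginibre = gaussian 1"
proof -
  have dens: "(\<Prod>i\<in>UNIV. \<Prod>j\<in>UNIV. std_normal_density (X $ i $ j)) = gaussian_density 1 X" for X :: "real^'n^'n"
  proof -
    have "(\<Prod>i\<in>UNIV. \<Prod>j\<in>UNIV. std_normal_density (X $ i $ j))
        = (\<Prod>i\<in>UNIV. \<Prod>j\<in>UNIV. (1 / sqrt (2 * pi)) * exp (- (X $ i $ j)\<^sup>2 / 2))"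
      by (simp add: std_normal_density_def)
    also have "\<dots> = (1 / sqrt (2 * pi)) ^ (CARD('n) * CARD('n)) * exp (\<Sum>i\<in>UNIV. \<Sum>j\<in>UNIV. - (X $ i $ j)\<^sup>2 / 2)"
      by (rule prod_prod_const_mult_exp)
    also have "(\<Sum>i\<in>UNIV. \<Sum>j\<in>UNIV. - (X $ i $ j)\<^sup>2 / 2) = - (norm X)\<^sup>2 / (2 * 1\<^sup>2)"
      by (simp add: norm_vec_power2 sum_divide_distrib sum_negf)
    finally show ?thesis unfolding gaussian_density_def by simp
  qed
  show ?thesis unfolding real_ginibre_def gaussian_def dens ..
qed

lemma complex_ginibre_eq_gaussian: "complex_ginibre = gaussian (1 / sqrt 2)"
proof -
  have dens: "(\<Prod>i\<in>UNIV. \<Prod>j\<in>UNIV. std_complex_normal_density (X $ i $ j)) = gaussian_density (1 / sqrt 2) X"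
    for X :: "complex^'n^'n"
  proof -
    have "(\<Prod>i\<in>UNIV. \<Prod>j\<in>UNIV. std_complex_normal_density (X $ i $ j))
        = (\<Prod>i\<in>UNIV. \<Prod>j\<in>UNIV. (1 / pi) * exp (- (cmod (X $ i $ j))\<^sup>2))"
      by (simp add: std_complex_normal_density_def)
    also have "\<dots> = (1 / pi) ^ (CARD('n) * CARD('n)) * exp (\<Sum>i\<in>UNIV. \<Sum>j\<in>UNIV. - (cmod (X $ i $ j))\<^sup>2)"
      by (rule prod_prod_const_mult_exp)
    also have "(\<Sum>i\<in>UNIV. \<Sum>j\<in>UNIV. - (cmod (X $ i $ j))\<^sup>2) = - (norm X)\<^sup>2 / (2 * (1 / sqrt 2)\<^sup>2)"
      by (simp add: norm_vec_power2 sum_negf power_divide)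
    also have "(1 / pi) ^ (CARD('n) * CARD('n)) = (1 / sqrt (2 * pi * (1 / sqrt 2)\<^sup>2)) ^ DIM(complex^'n^'n)"
    proof -
      have "DIM(complex^'n^'n) = 2 * (CARD('n) * CARD('n))" "2 * pi * (1 / sqrt 2)\<^sup>2 = pi"
        by (simp_all add: power_divide)
      then have "(1 / sqrt (2 * pi * (1 / sqrt 2)\<^sup>2)) ^ DIM(complex^'n^'n) = ((1 / sqrt pi)\<^sup>2) ^ (CARD('n) * CARD('n))"
        by (simp only: power_mult)
      then show ?thesis by (simp add: power_divide)
    qed
    finally show ?thesis unfolding gaussian_density_def by simp
  qed
  show ?thesis unfolding complex_ginibre_def gaussian_def dens ..
qed

theorem lemma15:
  shows "(\<exists>C \<delta>. \<delta> > 0 \<and> (\<forall>H :: (real^('n::{finite,linorder})^('n::{finite,linorder})) measure. haar_orthogonal H \<longrightarrow>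
            (\<forall>\<theta>::real. 0 \<le> \<theta> \<and> \<theta> < \<delta> \<longrightarrow>
              tv_dist (distr real_ginibre borel
                  (\<lambda>X. qr_Q_real ((1 - \<theta>) *\<^sub>R X + \<theta> *\<^sub>R mat 1))) H \<le> C * \<theta>)))
       \<and> (\<exists>C \<delta>. \<delta> > 0 \<and> (\<forall>H :: (complex^('n::{finite,linorder})^('n::{finite,linorder})) measure. haar_unitary H \<longrightarrow>
            (\<forall>\<theta>::real. 0 \<le> \<theta> \<and> \<theta> < \<delta> \<longrightarrow>
              tv_dist (distr complex_ginibre borel
                  (\<lambda>X. qr_Q_complex ((1 - \<theta>) *\<^sub>R X + \<theta> *\<^sub>R mat 1))) H \<le> C * \<theta>)))"
proof -
  interpret real: euclidean_conjugation "id :: real \<Rightarrow> real"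
    by (rule euclidean_conjugation_id)
  interpret complex: euclidean_conjugation cnj
    by (rule euclidean_conjugation_cnj)
  show ?thesis
    unfolding real_ginibre_eq_gaussian complex_ginibre_eq_gaussian qr_Q_real_eq qr_Q_complex_eq
      haar_orthogonal_eq haar_unitary_eq
    by (intro conjI real.tv_dist_qr_Q_perturbed_gaussian_haar complex.tv_dist_qr_Q_perturbed_gaussian_haar)
      simp_all
qed

end
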